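(* Let $H$ be a fixed graph such that $H$ is not an induced subgraph of $P_4$ and $H \notin \{3P_1,\ P_3+P_1,\ P_2+2P_1\}$. Then any streaming algorithm for \textsc{Diameter} in the AL model that uses $p$ passes over the stream must use $\Omega(n/p)$ bits of memory on $n$-vertex graphs $G$, even when $G$ is $H$-free.
   Context: Graphs are finite, simple, undirected, unweighted. $P_a$ is the path on $a$ vertices; $G_1+G_2$ is the disjoint union, and $sG$ is the disjoint union of $s$ copies of $G$. $G$ is $H$-free if it has no induced subgraph isomorphic to $H$. \textsc{Diameter}: compute $\max_{s,t} d(s,t)$ (shortest-path distance). In the Adjacency List (AL) streaming model the graph arrives as a sequence of vertices in arbitrary fixed order, each together with the full list of its incident edges (each edge appears twice). A $p$-pass algorithm reads the sequence $p$ times with unlimited computation; memory is measured in bits. "Must use $\Omega(f)$ bits" means there is a constant $c>0$ (depending on $H$) such that every $p$-pass algorithm solving the problem correctly on all inputs of the stated class uses at least $c\cdot f$ bits of memory on some $n$-vertex input, for all sufficiently large $n$ and all $p$. *)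

theory Defs
  imports "Graph_Theory.Graph_Theory"
begin

text \<open>
  Finite simple undirected graphs are \<^locale>\<open>pair_graph\<close>s: an undirected edge is
  represented by the two arcs joining its endpoints.
\<close>

section \<open>Graphs\<close>

definition isomorphic :: "'a pair_pre_digraph \<Rightarrow> 'b pair_pre_digraph \<Rightarrow> bool" where
  "isomorphic G H \<longleftrightarrow> digraph_iso (with_proj G) (with_proj H)"

definition has_induced :: "'a pair_pre_digraph \<Rightarrow> 'b pair_pre_digraph \<Rightarrow> bool" where
  "has_induced G H \<longleftrightarrow>
     (\<exists>K. induced_subgraph (with_proj K) (with_proj G) \<and> isomorphic K H)"

definition path_graph :: "nat \<Rightarrow> nat pair_pre_digraph" where
  "path_graph a =
     \<lparr> pverts = {..<a},
       parcs = {(i, j). i < a \<and> j < a \<and> (j = Suc i \<or> i = Suc j)} \<rparr>"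

definition disjoint_union ::
  "'a pair_pre_digraph \<Rightarrow> 'b pair_pre_digraph \<Rightarrow> ('a + 'b) pair_pre_digraph" where
  "disjoint_union G1 G2 =
     \<lparr> pverts = pverts G1 <+> pverts G2,
       parcs = {(Inl u, Inl v) | u v. (u, v) \<in> parcs G1} \<union>
               {(Inr u, Inr v) | u v. (u, v) \<in> parcs G2} \<rparr>"

definition copies :: "nat \<Rightarrow> 'a pair_pre_digraph \<Rightarrow> (nat \<times> 'a) pair_pre_digraph" where
  "copies s G =
     \<lparr> pverts = {..<s} \<times> pverts G,
       parcs = {((i, u), (i, v)) | i u v. i < s \<and> (u, v) \<in> parcs G} \<rparr>"

text \<open>
  The library's \<open>\<mu>\<close> with unit weights is the hop distance; it is \<open>\<infinity>\<close> when there is no walk,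
  so that the diameter of a disconnected graph is \<open>\<infinity>\<close>. On a finite nonempty vertex set
  the supremum is the maximum.
\<close>

definition distance :: "'a pair_pre_digraph \<Rightarrow> 'a \<Rightarrow> 'a \<Rightarrow> ereal" where
  "distance G s t = wf_digraph.\<mu> (with_proj G) (\<lambda>_. 1) s t"

definition diameter :: "'a pair_pre_digraph \<Rightarrow> ereal" where
  "diameter G = (SUP s\<in>pverts G. SUP t\<in>pverts G. distance G s t)"

definition free_graphs :: "'a pair_pre_digraph \<Rightarrow> nat \<Rightarrow> nat pair_pre_digraph set" where
  "free_graphs H n = {G. pair_graph G \<and> pverts G = {..<n} \<and> \<not> has_induced G H}"


section \<open>Adjacency list streams\<close>

text \<open>
  A stream item is a vertex \<open>v\<close> with a list of its incident edges; the edge \<open>vu\<close> is listed as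
  its other endpoint \<open>u\<close>. Both the order of the vertices and the order within each list are
  arbitrary.
\<close>

type_synonym al_item = "nat \<times> nat list"

definition al_stream :: "nat pair_pre_digraph \<Rightarrow> al_item list \<Rightarrow> bool" where
  "al_stream G xs \<longleftrightarrow>
     distinct (map fst xs) \<and> set (map fst xs) = pverts G \<and>
     (\<forall>(v, us)\<in>set xs. distinct us \<and> set us = {u. (v, u) \<in> parcs G})"

text \<open>
  The memory is a bit string. Computation is unlimited, so an algorithm is given by arbitrary
  functions. Their leading \<open>nat\<close> argument is the number of vertices, known in advance; an update
  may moreover consult the index of the current pass and the position in the stream. None of
  these is charged to the memory, and neither is the item being read: the memory is measured
  between items. Algorithms that have to store such data in their memory are a special case.
\<close>

record streaming_algorithm =
  initial :: "nat \<Rightarrow> bool list"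
  update :: "nat \<Rightarrow> nat \<Rightarrow> nat \<Rightarrow> al_item \<Rightarrow> bool list \<Rightarrow> bool list"
  answer :: "nat \<Rightarrow> bool list \<Rightarrow> ereal"

text \<open>Memory after \<open>k\<close> items have been read, where \<open>xs\<close> is read over and over again.\<close>

primrec memory :: "streaming_algorithm \<Rightarrow> al_item list \<Rightarrow> nat \<Rightarrow> bool list" where
  "memory A xs 0 = initial A (length xs)"
| "memory A xs (Suc k) =
     (let n = length xs
      in update A n (k div n) (k mod n) (xs ! (k mod n)) (memory A xs k))"

definition result :: "streaming_algorithm \<Rightarrow> nat \<Rightarrow> al_item list \<Rightarrow> ereal" where
  "result A p xs = answer A (length xs) (memory A xs (p * length xs))"

definition bits_used :: "streaming_algorithm \<Rightarrow> nat \<Rightarrow> al_item list \<Rightarrow> nat" where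
  "bits_used A p xs = (MAX k\<in>{..p * length xs}. length (memory A xs k))"

definition solves_diameter ::
  "streaming_algorithm \<Rightarrow> nat \<Rightarrow> nat pair_pre_digraph set \<Rightarrow> bool" where
  "solves_diameter A p \<G> \<longleftrightarrow>
     (\<forall>G\<in>\<G>. \<forall>xs. al_stream G xs \<longrightarrow> result A p xs = diameter G)"

end

theory Submission
  imports Defs
begin

text \<open>
  Split the stream into two halves such that the adjacency lists in the first half depend only on
  a set \<open>x \<subseteq> {..<k}\<close> and those in the second half only on \<open>y \<subseteq> {..<k}\<close>. A \<open>p\<close>-pass algorithm that
  decides from such streams whether \<open>x \<inter> y = {}\<close> is a communication protocol with \<open>2 p\<close> messages,
  and the \<open>2 ^ k\<close> pairs \<open>(x, - x)\<close> form a fooling set, so it needs at least \<open>k / (4 p)\<close> bits.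

  Three families of graphs with \<open>k\<close> linear in \<open>n\<close> encode disjointness in the diameter: split graphs
  (without induced \<open>2P\<^sub>2\<close>, \<open>C\<^sub>4\<close>, \<open>C\<^sub>5\<close>), graphs covered by three cliques (without induced \<open>4P\<^sub>1\<close>,
  \<open>P\<^sub>4 + P\<^sub>1\<close>), and unions of two matchings (without triangles and induced claws). A graph without
  any of these seven induced subgraphs is an induced subgraph of \<open>P\<^sub>4\<close> or one of the three exceptions.
\<close>

section \<open>Induced subgraphs as adjacency-preserving injections\<close>

text \<open>The image of \<open>f\<close> with all arcs of \<open>G\<close> inside it is the witness
  \<open>K\<close>, and the inverse of \<open>f\<close> is the isomorphism onto
  \<open>H\<close>.\<close>

lemma has_inducedI:
  assumes H: "pair_wf_digraph H" and G: "pair_wf_digraph G"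
    and f: "inj_on f (pverts H)" "f ` pverts H \<subseteq> pverts G"
    and arcs: "\<And>u v. u \<in> pverts H \<Longrightarrow> v \<in> pverts H \<Longrightarrow> (f u, f v) \<in> parcs G \<longleftrightarrow> (u, v) \<in> parcs H"
  shows "has_induced G H"
proof -
  interpret G: pair_wf_digraph G by fact
  interpret H: pair_wf_digraph H by fact
  let ?g = "the_inv_into (pverts H) f"
  let ?K = "\<lparr>pverts = f ` pverts H, parcs = {(u, v) \<in> parcs G. u \<in> f ` pverts H \<and> v \<in> f ` pverts H}\<rparr>"
  interpret K: pair_wf_digraph ?K by unfold_locales auto
  have g: "?g (f u) = u" if "u \<in> pverts H" for u
    using f(1) that by (rule the_inv_into_f_f)
  have "induced_subgraph (with_proj ?K) (with_proj G)"
    using f(2) G.wf_digraph_axioms K.wf_digraph_axioms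
    by (auto simp: induced_subgraph_def subgraph_def compatible_def)
  moreover have "digraph_iso (with_proj ?K) (with_proj H)"
    unfolding digraph_iso_def
  proof (intro exI conjI)
    let ?h = "\<lparr>iso_verts = ?g, iso_arcs = (\<lambda>(u, v). (?g u, ?g v)), iso_head = snd, iso_tail = fst\<rparr>"
    show "pre_digraph.digraph_isomorphism (with_proj ?K) ?h"
      using K.wf_digraph_axioms by (auto simp: pre_digraph.digraph_isomorphism_def inj_on_def g)
    have "parcs H = (\<lambda>(u, v). (?g u, ?g v)) ` parcs ?K"
    proof (intro set_eqI iffI)
      fix e assume e: "e \<in> parcs H"
      obtain u v where uv: "e = (u, v)" by (cases e)
      with e have "u \<in> pverts H" "v \<in> pverts H" by (auto dest: H.wellformed')
      with e uv arcs show "e \<in> (\<lambda>(u, v). (?g u, ?g v)) ` parcs ?K"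
        by (intro image_eqI[of _ _ "(f u, f v)"]) (auto simp: g)
    qed (auto simp: g arcs)
    then show "with_proj H = app_iso ?h (with_proj ?K)"
      by (force simp: app_iso_def with_proj_def g image_image)
  qed
  ultimately show ?thesis by (auto simp: has_induced_def isomorphic_def)
qed

lemma has_inducedE:
  assumes "has_induced G H"
  obtains f where "inj_on f (pverts H)" "f ` pverts H \<subseteq> pverts G"
    and "\<And>u v. u \<in> pverts H \<Longrightarrow> v \<in> pverts H \<Longrightarrow> (f u, f v) \<in> parcs G \<longleftrightarrow> (u, v) \<in> parcs H"
proof -
  obtain K where K: "induced_subgraph (with_proj K) (with_proj G)" "digraph_iso (with_proj K) (with_proj H)"
    using assms by (auto simp: has_induced_def isomorphic_def)
  then obtain h where h: "pre_digraph.digraph_isomorphism (with_proj K) h"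
    and H: "with_proj H = app_iso h (with_proj K)" by (auto simp: digraph_iso_def)
  interpret K: pair_wf_digraph K
    using h by (simp add: pre_digraph.digraph_isomorphism_def wf_digraph_wp_iff)
  let ?i = "iso_verts h" and ?f = "the_inv_into (pverts K) (iso_verts h)"
  have inj: "inj_on ?i (pverts K)"
    using h by (simp add: pre_digraph.digraph_isomorphism_def)
  have verts: "pverts H = ?i ` pverts K" and heads: "iso_tail h = fst" "iso_head h = snd"
    and arcs: "parcs H = iso_arcs h ` parcs K"
    using H by (simp_all add: with_proj_def app_iso_def)
  have h_arc: "iso_arcs h (u, v) = (?i u, ?i v)" if "(u, v) \<in> parcs K" for u v
    using h that by (auto simp: pre_digraph.digraph_isomorphism_def heads prod_eq_iff)
  have f: "?f (?i u) = u" if "u \<in> pverts K" for u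
    using inj that by (rule the_inv_into_f_f)
  have sub: "pverts K \<subseteq> pverts G"
    and K_arcs: "parcs K = {e \<in> parcs G. fst e \<in> pverts K \<and> snd e \<in> pverts K}"
    using K(1) unfolding induced_subgraph_def subgraph_def with_proj_simps by blast+
  show thesis
  proof
    show "inj_on ?f (pverts H)" by (auto simp: verts f inj_on_def)
    show "?f ` pverts H \<subseteq> pverts G" using sub by (auto simp: verts f)
    fix u v assume "u \<in> pverts H" "v \<in> pverts H"
    then obtain u' v' where uv: "u' \<in> pverts K" "v' \<in> pverts K" "u = ?i u'" "v = ?i v'"
      by (auto simp: verts)
    have "(?i u', ?i v') \<in> parcs H \<longleftrightarrow> (u', v') \<in> parcs K"
    proof
      assume "(?i u', ?i v') \<in> parcs H"
      then obtain a b where ab: "(a, b) \<in> parcs K" "(?i u', ?i v') = (?i a, ?i b)"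
        using h_arc by (auto simp: arcs)
      then have "u' = a" "v' = b"
        using uv inj K.wellformed'[OF ab(1)] by (auto dest: inj_onD)
      with ab show "(u', v') \<in> parcs K" by simp
    next
      assume "(u', v') \<in> parcs K"
      then have "iso_arcs h (u', v') \<in> parcs H" by (simp add: arcs)
      then show "(?i u', ?i v') \<in> parcs H" using h_arc \<open>(u', v') \<in> parcs K\<close> by simp
    qed
    moreover have "(u', v') \<in> parcs K \<longleftrightarrow> (u', v') \<in> parcs G"
      using uv(1,2) by (subst K_arcs) simp
    ultimately show "(?f u, ?f v) \<in> parcs G \<longleftrightarrow> (u, v) \<in> parcs H"
      unfolding uv(3,4) f[OF uv(1)] f[OF uv(2)] by simp
  qed
qed

text \<open>Adjacency-preserving injections compose. In contrapositive form this passes freeness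
  from a pattern to every \<open>H\<close> containing it.\<close>

lemma has_induced_trans:
  assumes "has_induced G H" "has_induced H K" "pair_wf_digraph G" "pair_wf_digraph K"
  shows "has_induced G K"
proof -
  obtain f where f: "inj_on f (pverts H)" "f ` pverts H \<subseteq> pverts G"
    "\<And>u v. u \<in> pverts H \<Longrightarrow> v \<in> pverts H \<Longrightarrow> (f u, f v) \<in> parcs G \<longleftrightarrow> (u, v) \<in> parcs H"
    using has_inducedE[OF assms(1)] by blast
  obtain g where g: "inj_on g (pverts K)" "g ` pverts K \<subseteq> pverts H"
    "\<And>u v. u \<in> pverts K \<Longrightarrow> v \<in> pverts K \<Longrightarrow> (g u, g v) \<in> parcs H \<longleftrightarrow> (u, v) \<in> parcs K"
    using has_inducedE[OF assms(2)] by blast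
  show ?thesis
  proof (rule has_inducedI[OF assms(4,3)])
    show "inj_on (f \<circ> g) (pverts K)" using f(1) g(1,2) by (auto intro: comp_inj_on inj_on_subset)
  qed (use f g in \<open>auto simp: image_subset_iff\<close>)
qed

lemma isomorphicI:
  assumes G: "pair_wf_digraph G" and H: "pair_wf_digraph H"
    and f: "bij_betw f (pverts G) (pverts H)"
    and arcs: "\<And>u v. u \<in> pverts G \<Longrightarrow> v \<in> pverts G \<Longrightarrow> (f u, f v) \<in> parcs H \<longleftrightarrow> (u, v) \<in> parcs G"
  shows "isomorphic G H"
  unfolding isomorphic_def digraph_iso_def
proof (intro exI conjI)
  interpret G: pair_wf_digraph G by fact
  interpret H: pair_wf_digraph H by fact
  have inj: "inj_on f (pverts G)" and im: "f ` pverts G = pverts H"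
    using f by (auto simp: bij_betw_def)
  let ?h = "\<lparr>iso_verts = f, iso_arcs = map_prod f f, iso_head = snd, iso_tail = fst\<rparr>"
  have "inj_on (map_prod f f) (parcs G)"
    by (rule inj_on_subset[OF map_prod_inj_on[OF inj inj]]) (auto dest: G.wellformed')
  then show "pre_digraph.digraph_isomorphism (with_proj G) ?h"
    using inj G.wf_digraph_axioms by (auto simp: pre_digraph.digraph_isomorphism_def)
  have "parcs H = map_prod f f ` parcs G"
  proof (intro set_eqI iffI)
    fix e assume e: "e \<in> parcs H"
    obtain a b where "e = (a, b)" by (cases e)
    with e im obtain u v where "e = (f u, f v)" "u \<in> pverts G" "v \<in> pverts G"
      by (metis H.wellformed' imageE)
    with e arcs show "e \<in> map_prod f f ` parcs G" by force
  qed (use arcs in \<open>auto dest: G.wellformed'\<close>)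
  then show "with_proj H = app_iso ?h (with_proj G)"
    by (simp add: app_iso_def with_proj_def im)
qed

section \<open>Graphs on initial segments of the naturals\<close>

definition graph_on :: "nat \<Rightarrow> (nat \<Rightarrow> nat \<Rightarrow> bool) \<Rightarrow> nat pair_pre_digraph" where
  "graph_on n F = \<lparr>pverts = {..<n}, parcs = {(u, v). u < n \<and> v < n \<and> F u v}\<rparr>"

abbreviation pattern :: "nat \<Rightarrow> (nat \<times> nat) set \<Rightarrow> nat pair_pre_digraph" where
  "pattern n es \<equiv> graph_on n (\<lambda>i j. (i, j) \<in> es \<or> (j, i) \<in> es)"

lemma graph_on_simps [simp]:
  "pverts (graph_on n F) = {..<n}"
  "(u, v) \<in> parcs (graph_on n F) \<longleftrightarrow> u < n \<and> v < n \<and> F u v"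
  by (simp_all add: graph_on_def)

lemma finite_parcs_graph_on: "finite (parcs (graph_on n F))"
  and card_parcs_graph_on: "card (parcs (graph_on n F)) \<le> n * n"
proof -
  have sub: "parcs (graph_on n F) \<subseteq> {..<n} \<times> {..<n}" by (auto simp: graph_on_def)
  then show "finite (parcs (graph_on n F))" by (rule finite_subset) simp
  show "card (parcs (graph_on n F)) \<le> n * n" using card_mono[OF _ sub] by simp
qed

lemma pair_wf_digraph_graph_on: "pair_wf_digraph (graph_on n F)"
  by unfold_locales auto

lemma pair_graph_graph_on:
  assumes "\<And>u v. F u v \<Longrightarrow> F v u" "\<And>u. \<not> F u u"
  shows "pair_graph (graph_on n F)"
proof -
  interpret pair_wf_digraph "graph_on n F" by (rule pair_wf_digraph_graph_on)
  show ?thesis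
    by unfold_locales
      (use assms in \<open>auto simp: finite_parcs_graph_on symmetric_def intro: symI\<close>)
qed

text \<open>A list of vertices in pattern order replaces the injection, so that for numeral
  \<open>n\<close> simplification unfolds the pattern into finitely many adjacencies.\<close>

lemma has_induced_graph_on_iff:
  assumes "pair_wf_digraph G"
  shows "has_induced G (graph_on n F) \<longleftrightarrow>
    (\<exists>vs. length vs = n \<and> distinct vs \<and> set vs \<subseteq> pverts G \<and>
      (\<forall>i<n. \<forall>j<n. (vs ! i, vs ! j) \<in> parcs G \<longleftrightarrow> F i j))"
proof
  assume "has_induced G (graph_on n F)"
  then obtain f where "inj_on f {..<n}" "f ` {..<n} \<subseteq> pverts G"
    "\<And>i j. i < n \<Longrightarrow> j < n \<Longrightarrow> (f i, f j) \<in> parcs G \<longleftrightarrow> F i j"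
    by (auto elim!: has_inducedE)
  then show "\<exists>vs. length vs = n \<and> distinct vs \<and> set vs \<subseteq> pverts G \<and>
      (\<forall>i<n. \<forall>j<n. (vs ! i, vs ! j) \<in> parcs G \<longleftrightarrow> F i j)"
    by (intro exI[of _ "map f [0..<n]"]) (auto simp: distinct_map atLeast0LessThan)
next
  assume "\<exists>vs. length vs = n \<and> distinct vs \<and> set vs \<subseteq> pverts G \<and>
      (\<forall>i<n. \<forall>j<n. (vs ! i, vs ! j) \<in> parcs G \<longleftrightarrow> F i j)"
  then show "has_induced G (graph_on n F)"
    by (auto intro!: has_inducedI[OF pair_wf_digraph_graph_on assms] inj_on_nth)
qed

section \<open>Distances as powers of the arc relation\<close>

lemma relpow_iff_awalk:
  assumes "pair_wf_digraph G"
  shows "(\<exists>q. pre_digraph.awalk (with_proj G) u q v \<and> length q = j) \<longleftrightarrow>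
    u \<in> pverts G \<and> (u, v) \<in> parcs G ^^ j"
proof -
  interpret pair_wf_digraph G by fact
  show ?thesis
  proof (induction j arbitrary: u)
    case 0
    then show ?case by (auto simp: awalk_def)
  next
    case (Suc j)
    have "(\<exists>q. awalk u q v \<and> length q = Suc j) \<longleftrightarrow>
      (\<exists>w. (u, w) \<in> parcs G \<and> (\<exists>q. awalk w q v \<and> length q = j))"
    proof safe
      fix q assume "awalk u q v" "length q = Suc j"
      then show "\<exists>w. (u, w) \<in> parcs G \<and> (\<exists>q. awalk w q v \<and> length q = j)"
        by (cases q) (fastforce simp: awalk_Cons_iff)+
    next
      fix w q assume "(u, w) \<in> parcs G" "awalk w q v" "j = length q"
      then show "\<exists>qa. awalk u qa v \<and> length qa = Suc (length q)"
        by (intro exI[of _ "(u, w) # q"]) (auto simp: awalk_Cons_iff)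
    qed
    also have "\<dots> \<longleftrightarrow> u \<in> pverts G \<and> (u, v) \<in> parcs G ^^ Suc j"
      unfolding Suc.IH
      by (auto dest: wellformed' intro: relpow_Suc_I2 elim!: relpow_Suc_E2 simp del: relpow.simps)
    finally show ?case .
  qed
qed

lemma diameter_le_iff:
  assumes "pair_wf_digraph G"
  shows "diameter G \<le> ereal (real d) \<longleftrightarrow>
    (\<forall>u\<in>pverts G. \<forall>v\<in>pverts G. \<exists>j\<le>d. (u, v) \<in> parcs G ^^ j)"
proof -
  interpret pair_wf_digraph G by fact
  have cost: "awalk_cost (\<lambda>_. 1) q = real (length q)" for q :: "('a \<times> 'a) list"
    by (induction q) auto
  have "distance G u v \<le> ereal (real d) \<longleftrightarrow> (\<exists>j\<le>d. (u, v) \<in> parcs G ^^ j)"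
    if u: "u \<in> pverts G" for u v
  proof
    assume "distance G u v \<le> ereal (real d)"
    \<comment> \<open>The strict bound \<open>Suc d\<close> on the infimum yields an actual walk,
      whose length is at most \<open>d\<close> because it is an integer.\<close>
    then have "(INF q\<in>{q. awalk u q v}. ereal (awalk_cost (\<lambda>_. 1) q)) < ereal (real (Suc d))"
      unfolding distance_def \<mu>_def by (rule order.strict_trans1) simp
    then obtain q where "awalk u q v" "length q < Suc d"
      unfolding INF_less_iff cost by auto
    then show "\<exists>j\<le>d. (u, v) \<in> parcs G ^^ j"
      using relpow_iff_awalk[OF assms, of u v "length q"] by (metis less_Suc_eq_le)
  next
    assume "\<exists>j\<le>d. (u, v) \<in> parcs G ^^ j"
    then obtain j where "j \<le> d" "(u, v) \<in> parcs G ^^ j" by blast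
    then obtain q where "awalk u q v" "length q \<le> d"
      using relpow_iff_awalk[OF assms, of u v j] u by auto
    then show "distance G u v \<le> ereal (real d)"
      unfolding distance_def \<mu>_def by (intro INF_lower2[of q]) (auto simp: cost)
  qed
  then show ?thesis unfolding diameter_def SUP_le_iff by simp
qed

section \<open>Induced subgraphs common to the remaining graphs\<close>

lemma pair_wf_digraph_path_graph: "pair_wf_digraph (path_graph a)"
  by unfold_locales (auto simp: path_graph_def)

lemma pair_wf_digraph_copies: "pair_wf_digraph G \<Longrightarrow> pair_wf_digraph (copies s G)"
  by (auto simp: pair_wf_digraph_def copies_def)

lemma pair_wf_digraph_disjoint_union:
  "pair_wf_digraph G1 \<Longrightarrow> pair_wf_digraph G2 \<Longrightarrow> pair_wf_digraph (disjoint_union G1 G2)"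
  by (auto simp: pair_wf_digraph_def disjoint_union_def)

lemma has_induced_graph_onI:
  assumes "pair_wf_digraph G" "length vs = n" "distinct vs" "set vs \<subseteq> pverts G"
    and "\<forall>i<n. \<forall>j<n. (vs ! i, vs ! j) \<in> parcs G \<longleftrightarrow> F i j"
  shows "has_induced G (graph_on n F)"
  using assms(2-) by (auto simp: has_induced_graph_on_iff[OF assms(1)])

lemma at_most_two_or_three:
  obtains "W = {}" | c where "W = {c}" | c d where "c \<noteq> d" "W = {c, d}"
    | c d e where "distinct [c, d, e]" "{c, d, e} \<subseteq> W"
proof (cases "W = {}")
  case False
  then obtain c where c: "c \<in> W" by blast
  show thesis
  proof (cases "W = {c}")
    case False
    then obtain d where d: "d \<in> W" "c \<noteq> d" using c by blast
    show thesis
    proof (cases "W = {c, d}")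
      case False
      then obtain e where "e \<in> W" "e \<noteq> c" "e \<noteq> d" using c d by blast
      then show thesis using that(4)[of c d e] c d by simp
    qed (use that(3) d in blast)
  qed (use that(2) in blast)
qed (use that(1) in blast)

text \<open>
  An induced \<open>P\<^sub>4\<close> is all of \<open>H\<close>. Otherwise an induced \<open>P\<^sub>3\<close> leaves room for at most one further vertex,
  which is isolated, and if there is none, an edge leaves room for at most two isolated vertices.
\<close>

lemma exceptional_if_no_pattern:
  fixes H :: "'a pair_pre_digraph"
  assumes "pair_graph H"
    and not_P4: "\<not> has_induced (path_graph 4) H"
    and not_3P1: "\<not> isomorphic H (copies 3 (path_graph 1))"
    and not_P3_P1: "\<not> isomorphic H (disjoint_union (path_graph 3) (path_graph 1))"
    and not_P2_2P1: "\<not> isomorphic H (disjoint_union (path_graph 2) (copies 2 (path_graph 1)))"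
    and no_triangle: "\<not> has_induced H (pattern 3 {(0, 1), (1, 2), (0, 2)})"
    and no_claw: "\<not> has_induced H (pattern 4 {(0, 1), (0, 2), (0, 3)})"
    and no_2P2: "\<not> has_induced H (pattern 4 {(0, 1), (2, 3)})"
    and no_C4: "\<not> has_induced H (pattern 4 {(0, 1), (1, 2), (2, 3), (3, 0)})"
    and no_C5: "\<not> has_induced H (pattern 5 {(0, 1), (1, 2), (2, 3), (3, 4), (4, 0)})"
    and no_4P1: "\<not> has_induced H (pattern 4 {})"
    and no_P4_P1: "\<not> has_induced H (pattern 5 {(0, 1), (1, 2), (2, 3)})"
  shows False
proof -
  interpret pair_graph H by fact
  define V where "V = pverts H"
  define E where "E u v \<longleftrightarrow> (u, v) \<in> parcs H" for u v
  have E_sym: "E u v \<longleftrightarrow> E v u" for u v using pair_sym_arcs by (auto simp: E_def symmetric_def dest: symD)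
  have irrefl: "\<not> E u u" for u using pair_no_loops[of "(u, u)"] by (auto simp: E_def)
  have V: "u \<in> V" "v \<in> V" if "E u v" for u v using that by (auto simp: E_def V_def dest: wellformed')
  have wf: "pair_wf_digraph H" ..
  note not_3P1_wf = pair_wf_digraph_copies[OF pair_wf_digraph_path_graph]
  note not_P3_P1_wf = pair_wf_digraph_disjoint_union[OF pair_wf_digraph_path_graph pair_wf_digraph_path_graph]
  note not_P2_2P1_wf = pair_wf_digraph_disjoint_union[OF pair_wf_digraph_path_graph not_3P1_wf]

  \<comment> \<open>Each excluded pattern is restated as a rule on \<open>E\<close>; in
    \<open>claw\<close> and \<open>C4\<close> the missing edges follow from the absence of
    triangles.\<close>
  have triangle: False if "E a b" "E b c" "E a c" for a b c
    by (rule notE[OF no_triangle has_induced_graph_onI[OF wf, of "[a, b, c]"]])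
      (use that V irrefl E_sym in \<open>auto simp: E_def V_def numeral_eq_Suc All_less_Suc2\<close>)
  have claw: False if "distinct [b, c, d]" "E a b" "E a c" "E a d" for a b c d
    by (rule notE[OF no_claw has_induced_graph_onI[OF wf, of "[a, b, c, d]"]])
      (use that triangle V irrefl E_sym in \<open>auto simp: E_def V_def numeral_eq_Suc All_less_Suc2\<close>)
  have TwoP2: False if "E a b" "E c d" "\<not> E a c" "\<not> E a d" "\<not> E b c" "\<not> E b d" for a b c d
    by (rule notE[OF no_2P2 has_induced_graph_onI[OF wf, of "[a, b, c, d]"]])
      (use that V irrefl E_sym in \<open>auto simp: E_def V_def numeral_eq_Suc All_less_Suc2\<close>)
  have C4: False if "E a b" "E b c" "E c d" "E a d" "a \<noteq> c" "b \<noteq> d" for a b c d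
    by (rule notE[OF no_C4 has_induced_graph_onI[OF wf, of "[a, b, c, d]"]])
      (use that triangle V irrefl E_sym in \<open>auto simp: E_def V_def numeral_eq_Suc All_less_Suc2\<close>)
  have C5: False if "distinct [a, b, c, d, e]" "E a b" "E b c" "E c d" "E d e" "E a e"
    "\<not> E a c" "\<not> E a d" "\<not> E b d" "\<not> E b e" "\<not> E c e" for a b c d e
    by (rule notE[OF no_C5 has_induced_graph_onI[OF wf, of "[a, b, c, d, e]"]])
      (use that V irrefl E_sym in \<open>auto simp: E_def V_def numeral_eq_Suc All_less_Suc2\<close>)
  have P4_P1: False if "distinct [a, b, c, d, e]" "{a, b, c, d, e} \<subseteq> V" "E a b" "E b c" "E c d" "\<not> E d e" "\<not> E a e"
    "\<not> E a c" "\<not> E a d" "\<not> E b d" "\<not> E b e" "\<not> E c e" for a b c d e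
    by (rule notE[OF no_P4_P1 has_induced_graph_onI[OF wf, of "[a, b, c, d, e]"]])
      (use that V irrefl E_sym in \<open>auto simp: E_def V_def numeral_eq_Suc All_less_Suc2\<close>)
  have FourP1: False if "distinct [a, b, c, d]" "{a, b, c, d} \<subseteq> V" "\<not> E a b" "\<not> E a c" "\<not> E a d"
    "\<not> E b c" "\<not> E b d" "\<not> E c d" for a b c d
    by (rule notE[OF no_4P1 has_induced_graph_onI[OF wf, of "[a, b, c, d]"]])
      (use that V irrefl E_sym in \<open>auto simp: E_def V_def numeral_eq_Suc All_less_Suc2\<close>)
  have embed: False if "inj_on f V" "f ` V \<subseteq> {..<4 :: nat}"
    "\<And>u v. u \<in> V \<Longrightarrow> v \<in> V \<Longrightarrow> E u v \<longleftrightarrow> f u = Suc (f v) \<or> f v = Suc (f u)" for f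
    by (rule notE[OF not_P4 has_inducedI[OF wf pair_wf_digraph_path_graph, of f]])
      (use that in \<open>auto simp: path_graph_def E_def V_def image_subset_iff\<close>)
  have no_P4: False if P4: "E a b" "E b c" "E c d" "\<not> E a c" "\<not> E a d" "\<not> E b d" "distinct [a, b, c, d]" for a b c d
  proof (cases "V = {a, b, c, d}")
    case True
    show False
      by (rule embed[of "\<lambda>v. if v = a then 0 else if v = b then 1 else if v = c then 2 else 3"])
        (use P4 True irrefl E_sym in \<open>auto simp: inj_on_def\<close>)
  next
    case False
    then obtain e where e: "e \<in> V" "e \<notin> {a, b, c, d}"
      using V[OF P4(1)] V[OF P4(3)] by blast
    \<comment> \<open>A further neighbour of \<open>b\<close> or \<open>c\<close> would complete a
      claw. So \<open>e\<close> is adjacent to both ends (\<open>C5\<close>), to one of them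
      (\<open>TwoP2\<close>) or to neither (\<open>P4_P1\<close>).\<close>
    have "\<not> E b e" "\<not> E c e"
      using claw[of a c e b] claw[of b d e c] P4 e E_sym by auto
    then show False
      using C5[of a b c d e] P4_P1[of a b c d e] TwoP2[of a e c d] TwoP2[of a b d e] P4 e V[OF P4(1)] V[OF P4(3)] E_sym
      by auto
  qed
  have no_P3: False if P3: "E a b" "E b c" "a \<noteq> c" for a b c
  proof -
    have abc: "a \<in> V" "b \<in> V" "c \<in> V" "a \<noteq> b" "b \<noteq> c" "\<not> E a c"
      using P3 V irrefl triangle by auto
    \<comment> \<open>A third neighbour of \<open>b\<close> gives a claw; a vertex adjacent to both
      \<open>a\<close> and \<open>c\<close> gives a \<open>C4\<close>, to just one of them an
      induced path on four vertices.\<close>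
    have isolated: "\<not> E a d" "\<not> E b d" "\<not> E c d" if d: "d \<in> V" "d \<notin> {a, b, c}" for d
    proof -
      show b: "\<not> E b d" using claw[of a c d b] P3 d E_sym by auto
      have "\<not> (E a d \<and> E c d)" using C4[of a b c d] P3 d by auto
      then show "\<not> E a d" "\<not> E c d"
        using no_P4[of d a b c] no_P4[of a b c d] P3 abc d b E_sym by auto
    qed
    consider "V = {a, b, c}" | d where "d \<notin> {a, b, c}" "V = {a, b, c, d}"
      | d e where "{d, e} \<subseteq> V" "d \<noteq> e" "d \<notin> {a, b, c}" "e \<notin> {a, b, c}"
      using abc by auto
    then show False
    proof cases
      case 1
      show False
        by (rule embed[of "\<lambda>v. if v = a then 0 else if v = b then 1 else 2"])
          (use P3 abc 1 irrefl E_sym in \<open>auto simp: inj_on_def\<close>)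
    next
      case (2 d)
      let ?f = "\<lambda>v. if v = a then Inl 0 else if v = b then Inl 1 else if v = c then Inl 2 else Inr 0"
      show False
      proof (rule notE[OF not_P3_P1 isomorphicI[OF wf not_P3_P1_wf, of ?f]])
        show "bij_betw ?f (pverts H) (pverts (disjoint_union (path_graph 3) (path_graph 1)))"
          using 2 abc P3 unfolding V_def[symmetric]
          by (auto simp: bij_betw_def inj_on_def disjoint_union_def path_graph_def lessThan_Suc numeral_eq_Suc)
      qed (use 2 abc P3 isolated[of d] irrefl E_sym in
        \<open>auto simp: disjoint_union_def path_graph_def V_def[symmetric] E_def[symmetric]\<close>)
    next
      \<comment> \<open>If \<open>d\<close> and \<open>e\<close> are adjacent, they form a
        \<open>2P\<^sub>2\<close> with \<open>a\<close>, \<open>b\<close>; otherwise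
        \<open>a\<close>, \<open>c\<close>, \<open>d\<close>, \<open>e\<close> are
        independent.\<close>
      case (3 d e)
      then show False
        using P3 isolated[of d] isolated[of e] TwoP2[of a b d e] FourP1[of a c d e] abc by auto
    qed
  qed
  have no_edge: False if ab: "E a b" for a b
  proof -
    have V_ab: "a \<in> V" "b \<in> V" "a \<noteq> b" using ab V irrefl by auto
    have isolated: "\<not> E c d" if "c \<in> V" "d \<in> V" "d \<notin> {a, b}" for c d
      using no_P3[of b a d] no_P3[of a b d] no_P3[of b a c] no_P3[of a b c] TwoP2[of a b c d]
        ab that E_sym[of a b] by blast
    show False
    proof (cases "V - {a, b}" rule: at_most_two_or_three)
      case 1
      then have 1: "V = {a, b}" using V_ab by blast
      show False
        by (rule embed[of "\<lambda>v. if v = a then 0 else 1"])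
          (use ab V_ab 1 irrefl E_sym in \<open>auto simp: inj_on_def\<close>)
    next
      case (2 c)
      then have 2: "V = {a, b, c}" "c \<notin> {a, b}" using V_ab by blast+
      \<comment> \<open>An edge and an isolated vertex sit on the path at positions 0, 1 and
        3.\<close>
      show False
        by (rule embed[of "\<lambda>v. if v = a then 0 else if v = b then 1 else 3"])
          (use ab V_ab 2 irrefl E_sym isolated in \<open>auto simp: inj_on_def\<close>)
    next
      case (3 c d)
      then have 3: "V = {a, b, c, d}" "c \<notin> {a, b}" "d \<notin> {a, b}" "c \<noteq> d" using V_ab by blast+
      let ?f = "\<lambda>v. if v = a then Inl 0 else if v = b then Inl 1 else if v = c then Inr (0, 0) else Inr (1, 0)"
      show False
      proof (rule notE[OF not_P2_2P1 isomorphicI[OF wf not_P2_2P1_wf, of ?f]])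
        show "bij_betw ?f (pverts H) (pverts (disjoint_union (path_graph 2) (copies 2 (path_graph 1))))"
          using 3 V_ab unfolding V_def[symmetric]
          by (auto simp: bij_betw_def inj_on_def disjoint_union_def copies_def path_graph_def lessThan_Suc numeral_eq_Suc)
      qed (use 3 V_ab ab isolated irrefl E_sym in
        \<open>auto simp: disjoint_union_def copies_def path_graph_def V_def[symmetric] E_def[symmetric]\<close>)
    next
      case (4 c d e)
      then show False using isolated FourP1[of a c d e] V_ab by auto
    qed
  qed
  show False
  proof (cases V rule: at_most_two_or_three)
    case 1
    show False by (rule embed[of "\<lambda>_. 0"]) (use 1 in auto)
  next
    case (2 a)
    show False by (rule embed[of "\<lambda>_. 0"]) (use 2 no_edge in auto)
  next
    case (3 a b)
    show False
      by (rule embed[of "\<lambda>v. if v = a then 0 else 2"]) (use 3 no_edge in \<open>auto simp: inj_on_def\<close>)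
  next
    case (4 a b c)
    show False
    proof (cases "V = {a, b, c}")
      case True
      let ?f = "\<lambda>v. if v = a then (0, 0) else if v = b then (1, 0) else (2, 0)"
      show False
      proof (rule notE[OF not_3P1 isomorphicI[OF wf not_3P1_wf, of ?f]])
        show "bij_betw ?f (pverts H) (pverts (copies 3 (path_graph 1)))"
          using True 4 unfolding V_def[symmetric]
          by (auto simp: bij_betw_def inj_on_def copies_def path_graph_def lessThan_Suc numeral_eq_Suc)
      qed (use True 4 no_edge in
        \<open>auto simp: copies_def path_graph_def V_def[symmetric] E_def[symmetric]\<close>)
    next
      case False
      then obtain d where "d \<in> V" "d \<notin> {a, b, c}" using 4 by blast
      then show False using 4(1,2) no_edge FourP1[of a b c d] by auto
    qed
  qed
qed

section \<open>Disjointness and streaming\<close>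

text \<open>Cut and paste: in every pass the run on \<open>zs\<close> follows \<open>xs\<close> up
  to position \<open>a\<close> and \<open>ys\<close> from there on, because at each handover the
  runs on \<open>xs\<close> and \<open>ys\<close> hold the same memory. Positions 0 and
  \<open>a\<close> belong to both sides, which lets the induction change over.\<close>

lemma memory_crossing:
  assumes len: "length xs = n" "length ys = n" "length zs = n" and "a \<le> n"
    and zs: "\<And>i. i < a \<Longrightarrow> zs ! i = xs ! i" "\<And>i. a \<le> i \<Longrightarrow> i < n \<Longrightarrow> zs ! i = ys ! i"
    and agree: "\<And>k. k \<le> m \<Longrightarrow> k mod n \<in> {0, a} \<Longrightarrow> memory A xs k = memory A ys k"
    and "k \<le> m"
  shows "(k mod n \<le> a \<longrightarrow> memory A zs k = memory A xs k) \<and>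
    (k mod n = 0 \<or> a \<le> k mod n \<longrightarrow> memory A zs k = memory A ys k)"
  using \<open>k \<le> m\<close>
proof (induction k)
  case 0
  then show ?case by (simp add: len)
next
  case (Suc k)
  show ?case
  proof (cases "n = 0")
    case True
    then show ?thesis using len by simp
  next
    case n: False
    let ?r = "k mod n"
    have r: "?r < n" using n by simp
    have mod_Suc: "Suc k mod n = (if Suc ?r = n then 0 else Suc ?r)" by (rule mod_Suc)
    show ?thesis
    proof (cases "?r < a")
      case True
      then have "memory A zs (Suc k) = memory A xs (Suc k)"
        using Suc zs(1) len by (simp add: Let_def)
      then show ?thesis
        using agree[of "Suc k"] Suc.prems True mod_Suc \<open>a \<le> n\<close> by (auto split: if_splits)
    next
      case False
      then have "memory A zs (Suc k) = memory A ys (Suc k)"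
        using Suc zs(2) len r by (simp add: Let_def)
      then show ?thesis
        using agree[of "Suc k"] Suc.prems False mod_Suc by (auto split: if_splits)
    qed
  qed
qed

text \<open>The exact number is \<open>2 ^ (b + 1) - 1\<close>; the cruder power of 4 covers
  \<open>b = 0\<close> as well and keeps the exponent proportional to \<open>b\<close>.\<close>

lemma card_bool_lists_length_le: "card {bs :: bool list. length bs \<le> b} \<le> 4 ^ b"
proof -
  have "card {bs :: bool list. length bs \<le> b} = (\<Sum>i\<le>b. 2 ^ i)"
    using card_lists_length_le[of "UNIV :: bool set" b] by simp
  also have "\<dots> \<le> 4 ^ b"
  proof (induction b)
    case (Suc b)
    then show ?case using power_mono[of 2 "4 :: nat" b] by simp
  qed simp
  finally show ?thesis .
qed

text \<open>Sorting makes the item depend on the neighbourhood of \<open>v\<close> alone, so graphs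
  that agree there yield the same item.\<close>

definition item :: "nat pair_pre_digraph \<Rightarrow> nat \<Rightarrow> al_item" where
  "item G v = (v, sorted_list_of_set {u. (v, u) \<in> parcs G})"

lemma al_stream_map_item:
  assumes "pair_graph G" "distinct vs" "set vs = pverts G"
  shows "al_stream G (map (item G) vs)"
proof -
  interpret pair_graph G by fact
  have "finite {u. (v, u) \<in> parcs G}" for v
    by (rule finite_subset[OF _ pair_finite_verts]) (auto dest: wellformed')
  moreover have "fst \<circ> item G = (\<lambda>v. v)" by (auto simp: item_def)
  ultimately show ?thesis
    using assms by (auto simp: al_stream_def item_def)
qed

lemma bits_used_ge: "k \<le> p * length xs \<Longrightarrow> length (memory A xs k) \<le> bits_used A p xs"
  unfolding bits_used_def by (intro Max_ge) auto

text \<open>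
  If the streams of two pairs \<open>(x, - x)\<close> and \<open>(x', - x')\<close> leave the same memory at the end of
  both halves in every pass, then the algorithm cannot tell them from the streams with the halves
  interchanged, one of which belongs to an intersecting pair.
\<close>

lemma disjointness_bits_used:
  fixes F :: "nat set \<Rightarrow> nat set \<Rightarrow> nat \<Rightarrow> nat \<Rightarrow> bool" and S :: "nat set"
  assumes sym: "\<And>x y u v. F x y u v \<Longrightarrow> F x y v u" and irrefl: "\<And>x y u. \<not> F x y u u"
    and S: "\<And>x y y' u v. u \<in> S \<Longrightarrow> F x y u v \<Longrightarrow> F x y' u v"
    and not_S: "\<And>x x' y u v. u \<notin> S \<Longrightarrow> F x y u v \<Longrightarrow> F x' y u v"
    and diameter: "\<And>x y. x \<subseteq> {..<k} \<Longrightarrow> y \<subseteq> {..<k} \<Longrightarrow>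
      diameter (graph_on n (F x y)) \<le> d \<longleftrightarrow> x \<inter> y = {}"
    and \<G>: "\<And>x y. graph_on n (F x y) \<in> \<G>"
    and A: "solves_diameter A p \<G>"
  shows "\<exists>x y xs. al_stream (graph_on n (F x y)) xs \<and> k \<le> 4 * p * bits_used A p xs"
proof -
  \<comment> \<open>The vertices in \<open>S\<close> come first; their lists depend on
    \<open>x\<close> only, those of the other vertices on \<open>y\<close> only.\<close>
  define as where "as = filter (\<lambda>v. v \<in> S) [0..<n]"
  define bs where "bs = filter (\<lambda>v. v \<notin> S) [0..<n]"
  define G where "G x y = graph_on n (F x y)" for x y
  define st where "st x y = map (item (G x y)) (as @ bs)" for x y
  define a where "a = length as"
  have "a + length bs = n"
    unfolding a_def as_def bs_def using sum_length_filter_compl[of "\<lambda>v. v \<in> S" "[0..<n]"] by simp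
  then have len: "length (st x y) = n" and "a \<le> n" for x y
    by (simp_all add: st_def a_def)
  have stream: "al_stream (G x y) (st x y)" for x y
    unfolding st_def G_def
    by (rule al_stream_map_item)
      (auto simp: as_def bs_def intro!: pair_graph_graph_on sym irrefl)
  have item_S: "item (G x y) v = item (G x y') v" if "v \<in> S" for x y y' v
    unfolding item_def G_def graph_on_simps using S[OF that] by meson
  have item_not_S: "item (G x y) v = item (G x' y) v" if "v \<notin> S" for x x' y v
    unfolding item_def G_def graph_on_simps using not_S[OF that] by meson
  have st_left: "st x y ! i = st x y' ! i" if "i < a" for x y y' i
  proof -
    have "as ! i \<in> set as" using that by (simp add: a_def)
    then have "as ! i \<in> S" by (simp add: as_def)
    then show ?thesis using that item_S by (simp add: st_def nth_append a_def)
  qed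
  have st_right: "st x y ! i = st x' y ! i" if "a \<le> i" "i < n" for x x' y i
  proof -
    have i: "i - a < length bs" using that \<open>a + length bs = n\<close> by simp
    then have "bs ! (i - a) \<in> set bs" by simp
    then have "bs ! (i - a) \<notin> S" by (simp add: bs_def)
    then show ?thesis using that i item_not_S by (simp add: st_def nth_append a_def)
  qed
  define co where "co x = {..<k} - x" for x
  \<comment> \<open>The maximum over finitely many pairs is attained; the stream of such a pair is
    the final witness.\<close>
  define b where "b = Max ((\<lambda>(x, y). bits_used A p (st x y)) ` (Pow {..<k} \<times> Pow {..<k}))"
  have b_le: "bits_used A p (st x y) \<le> b" if "x \<subseteq> {..<k}" "y \<subseteq> {..<k}" for x y
    unfolding b_def using that by (intro Max_ge) auto
  have "b \<in> (\<lambda>(x, y). bits_used A p (st x y)) ` (Pow {..<k} \<times> Pow {..<k})"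
    unfolding b_def by (intro Max_in) auto
  then obtain x\<^sub>0 y\<^sub>0 where b: "b = bits_used A p (st x\<^sub>0 y\<^sub>0)" by auto
  \<comment> \<open>Even indices mark position \<open>a\<close> of pass \<open>i div 2\<close>, odd
    ones the end of that pass; these are the \<open>2 * p\<close> messages.\<close>
  define checkpoints where "checkpoints = map (\<lambda>i. (i div 2) * n + (if even i then a else n)) [0..<2 * p]"
  define transcript where "transcript x = map (memory A (st x (co x))) checkpoints" for x
  have checkpoints_le: "c \<le> p * n" if "c \<in> set checkpoints" for c
  proof -
    have "c \<in> (\<lambda>i. (i div 2) * n + (if even i then a else n)) ` {0..<2 * p}"
      using that by (simp add: checkpoints_def)
    then obtain i where i: "i \<in> {0..<2 * p}" "c = (i div 2) * n + (if even i then a else n)"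
      by (rule imageE)
    have "c \<le> Suc (i div 2) * n" using \<open>a \<le> n\<close> i by auto
    also have "\<dots> \<le> p * n" using i by (intro mult_right_mono) auto
    finally show ?thesis .
  qed
  have checkpoints_ex: "c = 0 \<or> c \<in> set checkpoints" if "c \<le> p * n" "c mod n \<in> {0, a}" for c
  proof (cases "c = 0")
    case False
    with that have "n > 0" by (cases n) auto
    define q where "q = c div n"
    have c: "c = q * n + c mod n" by (simp add: q_def)
    show ?thesis
    proof (cases "c mod n = 0")
      case True
      then have "q \<noteq> 0" "q \<le> p" using c \<open>c \<noteq> 0\<close> that(1) \<open>n > 0\<close> by auto
      then obtain q' where "q = Suc q'" "q' < p" by (cases q) auto
      then show ?thesis unfolding checkpoints_def using c True
        by (intro disjI2) (auto intro!: image_eqI[of _ _ "2 * q' + 1"])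
    next
      case False
      then have "c mod n = a" using that by auto
      moreover have "q < p"
        using c that(1) False \<open>n > 0\<close> by (metis add_leD1 le_antisym le_neq_implies_less
          mult_le_cancel2 add_le_same_cancel1 le_zero_eq)
      ultimately show ?thesis unfolding checkpoints_def using c
        by (intro disjI2) (auto intro!: image_eqI[of _ _ "2 * q"])
    qed
  qed simp
  have result: "result A p (st x y) \<le> d \<longleftrightarrow> x \<inter> y = {}" if "x \<subseteq> {..<k}" "y \<subseteq> {..<k}" for x y
  proof -
    have "result A p (st x y) = diameter (graph_on n (F x y))"
      using A \<G>[of x y] stream[of x y] unfolding solves_diameter_def G_def by blast
    then show ?thesis using diameter[OF that] by simp
  qed
  have inj: "inj_on transcript (Pow {..<k})"
  proof (rule inj_onI, goal_cases)
    case (1 x x')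
    have agree: "memory A (st x (co x)) c = memory A (st x' (co x')) c"
      if "c \<le> p * n" "c mod n \<in> {0, a}" for c
      using checkpoints_ex[OF that] 1(3) by (auto simp: transcript_def len)
    \<comment> \<open>By \<open>memory_crossing\<close> the answer on the mixed pair
      \<open>(z, co z')\<close> is that on the disjoint pair \<open>(z, co z)\<close>, so
      \<open>z \<subseteq> z'\<close>. Applied both ways this gives \<open>x = x'\<close>.\<close>
    have cross: "z \<inter> co z' = {}"
      if z: "z \<subseteq> {..<k}" "z' \<subseteq> {..<k}"
        and ag: "\<And>c. c \<le> p * n \<Longrightarrow> c mod n \<in> {0, a} \<Longrightarrow>
          memory A (st z (co z)) c = memory A (st z' (co z')) c" for z z'
    proof -
      have "memory A (st z (co z')) (p * n) = memory A (st z (co z)) (p * n)"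
        using memory_crossing[where xs = "st z (co z)" and ys = "st z' (co z')" and zs = "st z (co z')"
            and k = "p * n" and m = "p * n" and A = A, OF len len len \<open>a \<le> n\<close>] st_left st_right ag
        by simp
      then have "result A p (st z (co z')) = result A p (st z (co z))"
        by (simp add: result_def len)
      moreover have "co z \<subseteq> {..<k}" for z by (auto simp: co_def)
      ultimately show ?thesis using result z by (metis Diff_disjoint co_def)
    qed
    have "x \<inter> co x' = {}" by (rule cross) (use 1 agree in auto)
    moreover have "x' \<inter> co x = {}" by (rule cross) (use 1 agree in auto)
    ultimately show "x = x'" using 1 by (auto simp: co_def)
  qed
  let ?T = "{l. set l \<subseteq> {bs :: bool list. length bs \<le> b} \<and> length l = 2 * p}"
  have fin: "finite {bs :: bool list. length bs \<le> b}"
    using finite_lists_length_le[of "UNIV :: bool set" b] by simp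
  have "transcript ` Pow {..<k} \<subseteq> ?T"
  proof clarsimp
    fix x assume x: "x \<subseteq> {..<k}"
    have "length (memory A (st x (co x)) c) \<le> b" if "c \<in> set checkpoints" for c
      using bits_used_ge[of c p "st x (co x)" A] checkpoints_le[OF that] b_le[of x "co x"] x
      by (auto simp: len co_def)
    then show "set (transcript x) \<subseteq> {bs. length bs \<le> b} \<and> length (transcript x) = 2 * p"
      by (auto simp: transcript_def checkpoints_def)
  qed
  \<comment> \<open>There are \<open>2 ^ k\<close> transcripts, each a list of \<open>2 * p\<close>
    strings of at most \<open>b\<close> bits; comparing exponents of 2 gives the bound.\<close>
  then have "2 ^ k \<le> card ?T"
    using card_inj_on_le[OF inj, of ?T] finite_lists_length_eq[OF fin] by (simp add: card_Pow)
  also have "\<dots> = card {bs :: bool list. length bs \<le> b} ^ (2 * p)"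
    by (rule card_lists_length_eq[OF fin])
  also have "\<dots> \<le> (4 ^ b) ^ (2 * p)"
    by (intro power_mono card_bool_lists_length_le) simp
  also have "\<dots> = 2 ^ (4 * p * b)"
    using power_mult[of "2 :: nat" 2 "b * (2 * p)"] by (simp add: power_mult[symmetric] mult_ac)
  finally have "k \<le> 4 * p * b" by simp
  then show ?thesis using stream b unfolding G_def by metis
qed

section \<open>Split graphs and three cliques\<close>

lemma has_induced_pullbackE:
  assumes "has_induced (graph_on n (\<lambda>u v. R (dec u) (dec v))) (graph_on l F)" "inj_on dec {..<n}"
  obtains vs where "length vs = l" "distinct vs" "\<forall>i<l. \<forall>j<l. R (vs ! i) (vs ! j) \<longleftrightarrow> F i j"
proof -
  obtain us where us: "length us = l" "distinct us" "set us \<subseteq> {..<n}"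
    "\<forall>i<l. \<forall>j<l. (us ! i < n \<and> us ! j < n \<and> R (dec (us ! i)) (dec (us ! j))) \<longleftrightarrow> F i j"
    using assms(1) unfolding has_induced_graph_on_iff[OF pair_wf_digraph_graph_on] graph_on_simps by blast
  show thesis
  proof (rule that)
    show "distinct (map dec us)"
      using us(2,3) assms(2) by (auto simp: distinct_map intro: inj_on_subset)
    have "us ! i < n" if "i < l" for i using us(1,3) that by (metis lessThan_iff nth_mem subsetD)
    then show "\<forall>i<l. \<forall>j<l. R (map dec us ! i) (map dec us ! j) \<longleftrightarrow> F i j"
      using us(1,4) by simp
  qed (simp add: us(1))
qed

lemma diameter_graph_on_le_two_iff:
  "diameter (graph_on n F) \<le> 2 \<longleftrightarrow>
    (\<forall>u<n. \<forall>v<n. u = v \<or> F u v \<or> (\<exists>w<n. F u w \<and> F w v))"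
proof -
  have two: "(\<exists>j\<le>2. P j) \<longleftrightarrow> P 0 \<or> P 1 \<or> P (2 :: nat)" for P
    by (metis One_nat_def Suc_1 le_SucE le_zero_eq order_refl zero_le le_Suc_eq)
  have "(\<exists>j\<le>2. (u, v) \<in> parcs (graph_on n F) ^^ j) \<longleftrightarrow>
      u = v \<or> F u v \<or> (\<exists>w<n. F u w \<and> F w v)" if "u < n" "v < n" for u v
    unfolding two using that by (auto simp: numeral_2_eq_2 relcomp_unfold)
  then show ?thesis
    using diameter_le_iff[OF pair_wf_digraph_graph_on, of n F 2] by auto
qed

text \<open>
  The pair \<open>AV i\<close>, \<open>BV j\<close> with \<open>i \<noteq> j\<close> has the common neighbour \<open>WV i\<close>; the common neighbours of \<open>AV i\<close>
  and \<open>BV i\<close> are \<open>CV\<close> if \<open>i \<notin> x\<close> and \<open>DV\<close> if \<open>i \<notin> y\<close>. All other distances are at most 2, because \<open>CV\<close> is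
  adjacent to every \<open>BV j\<close> and \<open>DV\<close> to every \<open>AV i\<close>. The flag \<open>t\<close> chooses between independent sets
  and cliques on the \<open>AV i\<close> and on the \<open>BV j\<close>, which has no influence on this.
\<close>

datatype vertex = AV nat | BV nat | WV nat | CV | DV

text \<open>Each pair of kinds is listed in one orientation; the last equation also makes
  \<open>AV\<close> and \<open>BV\<close> non-adjacent. Only the pairs \<open>AV\<close>,
  \<open>CV\<close> depend on \<open>x\<close> and only the pairs \<open>BV\<close>,
  \<open>DV\<close> on \<open>y\<close>, which permits splitting the stream.\<close>

fun half_adj :: "bool \<Rightarrow> nat set \<Rightarrow> nat set \<Rightarrow> vertex \<Rightarrow> vertex \<Rightarrow> bool" where
  "half_adj t x y (AV i) (AV j) \<longleftrightarrow> t \<and> i \<noteq> j"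
| "half_adj t x y (BV i) (BV j) \<longleftrightarrow> t \<and> i \<noteq> j"
| "half_adj t x y (WV i) (WV j) \<longleftrightarrow> i \<noteq> j"
| "half_adj t x y (AV i) (WV j) \<longleftrightarrow> i = j"
| "half_adj t x y (BV i) (WV j) \<longleftrightarrow> i \<noteq> j"
| "half_adj t x y (AV i) CV \<longleftrightarrow> i \<notin> x"
| "half_adj t x y (BV i) DV \<longleftrightarrow> i \<notin> y"
| "half_adj t x y (AV i) DV \<longleftrightarrow> True"
| "half_adj t x y (BV i) CV \<longleftrightarrow> True"
| "half_adj t x y (WV i) CV \<longleftrightarrow> True"
| "half_adj t x y (WV i) DV \<longleftrightarrow> True"
| "half_adj t x y CV DV \<longleftrightarrow> True"
| "half_adj t x y _ _ \<longleftrightarrow> False"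

definition adj :: "bool \<Rightarrow> nat set \<Rightarrow> nat set \<Rightarrow> vertex \<Rightarrow> vertex \<Rightarrow> bool" where
  "adj t x y u v \<longleftrightarrow> half_adj t x y u v \<or> half_adj t x y v u"

text \<open>The number \<open>m\<close> may exceed \<open>k\<close>, so that every number of vertices is attained.\<close>

definition vertices :: "nat \<Rightarrow> nat \<Rightarrow> vertex set" where
  "vertices m k = AV ` {..<m} \<union> BV ` {..<k} \<union> WV ` {..<k} \<union> {CV, DV}"

lemma card_vertices: "card (vertices m k) = m + 2 * k + 2" and finite_vertices: "finite (vertices m k)"
proof -
  have "card (WV ` {..<k} \<union> {CV, DV}) = k + 2"
    by (subst card_Un_disjoint) (auto simp: card_image inj_on_def)
  moreover have "card (BV ` {..<k} \<union> (WV ` {..<k} \<union> {CV, DV})) = k + card (WV ` {..<k} \<union> {CV, DV})"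
    by (subst card_Un_disjoint) (auto simp: card_image inj_on_def)
  moreover have "card (AV ` {..<m} \<union> (BV ` {..<k} \<union> (WV ` {..<k} \<union> {CV, DV}))) =
      m + card (BV ` {..<k} \<union> (WV ` {..<k} \<union> {CV, DV}))"
    by (subst card_Un_disjoint) (auto simp: card_image inj_on_def)
  ultimately show "card (vertices m k) = m + 2 * k + 2"
    unfolding vertices_def Un_assoc by linarith
  show "finite (vertices m k)" by (simp add: vertices_def)
qed

lemma adj_distance_two_iff:
  assumes xy: "x \<subseteq> {..<k}" "y \<subseteq> {..<k}" and "k \<le> m"
  shows "(\<forall>u\<in>vertices m k. \<forall>v\<in>vertices m k.
      u = v \<or> adj t x y u v \<or> (\<exists>w\<in>vertices m k. adj t x y u w \<and> adj t x y w v)) \<longleftrightarrow> x \<inter> y = {}"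
    (is "(\<forall>u\<in>?V. \<forall>v\<in>?V. ?near u v) \<longleftrightarrow> _")
proof
  assume near: "\<forall>u\<in>?V. \<forall>v\<in>?V. ?near u v"
  show "x \<inter> y = {}"
  proof (rule equals0I)
    fix i assume i: "i \<in> x \<inter> y"
    then have "AV i \<in> ?V" "BV i \<in> ?V" using xy \<open>k \<le> m\<close> by (auto simp: vertices_def)
    with near have "?near (AV i) (BV i)" by blast
    then obtain w where "adj t x y (AV i) w" "adj t x y w (BV i)"
      by (auto simp: adj_def)
    then show False using i by (cases w) (auto simp: adj_def)
  qed
next
  assume disj: "x \<inter> y = {}"
  have C: "CV \<in> ?V" and D: "DV \<in> ?V" by (auto simp: vertices_def)
  have sym: "?near u v \<Longrightarrow> ?near v u" for u v by (auto simp: adj_def)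
  have AB: "?near (AV i) (BV j)" if "AV i \<in> ?V" "BV j \<in> ?V" for i j
  proof -
    \<comment> \<open>For \<open>i \<ge> k\<close> there is no \<open>WV i\<close>, but then
      \<open>i \<notin> x\<close> and the first case applies.\<close>
    consider "i \<notin> x" | "i = j" "j \<notin> y" | "i \<noteq> j" "i < k" using disj xy by auto
    then show ?thesis
    proof cases
      case 1
      then show ?thesis by (intro disjI2 bexI[OF _ C]) (simp add: adj_def)
    next
      case 2
      then show ?thesis by (intro disjI2 bexI[OF _ D]) (simp add: adj_def)
    next
      case 3
      then have "WV i \<in> ?V" by (auto simp: vertices_def)
      then show ?thesis using 3 by (intro disjI2 bexI[of _ "WV i"]) (auto simp: adj_def)
    qed
  qed
  show "\<forall>u\<in>?V. \<forall>v\<in>?V. ?near u v"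
  proof (intro ballI)
    fix u v assume uv: "u \<in> ?V" "v \<in> ?V"
    consider i j where "u = AV i" "v = BV j" | i j where "u = BV i" "v = AV j"
      | "adj t x y u CV" "adj t x y CV v" | "adj t x y u DV" "adj t x y DV v"
      | "u = v \<or> adj t x y u v"
      by (cases u; cases v) (auto simp: adj_def)
    then show "?near u v"
      using AB sym uv C D by cases blast+
  qed
qed

lemma diameter_adj_le_two_iff:
  assumes dec: "bij_betw dec {..<n} (vertices m k)"
    and "x \<subseteq> {..<k}" "y \<subseteq> {..<k}" "k \<le> m"
  shows "diameter (graph_on n (\<lambda>u v. adj t x y (dec u) (dec v))) \<le> 2 \<longleftrightarrow> x \<inter> y = {}"
proof -
  have inj: "dec u = dec v \<longleftrightarrow> u = v" if "u < n" "v < n" for u v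
    using dec that by (auto simp: bij_betw_def inj_on_def)
  have V: "vertices m k = dec ` {..<n}" using dec by (simp add: bij_betw_def)
  show ?thesis
    unfolding diameter_graph_on_le_two_iff adj_distance_two_iff[OF assms(2-), of t, symmetric] V
      ball_simps bex_simps Ball_def Bex_def lessThan_iff
    using inj by blast
qed

section \<open>Induced subgraphs excluded from the split graphs\<close>

text \<open>The clique side of the split graph for \<open>t = False\<close>.\<close>

definition hub :: "vertex \<Rightarrow> bool" where
  "hub u \<longleftrightarrow> (case u of AV _ \<Rightarrow> False | BV _ \<Rightarrow> False | _ \<Rightarrow> True)"

lemma split_adj:
  shows "adj False x y u v \<Longrightarrow> hub u \<or> hub v"
    and "hub u \<Longrightarrow> hub v \<Longrightarrow> u \<noteq> v \<Longrightarrow> adj False x y u v"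
  by (cases u; cases v; simp add: adj_def hub_def)+

lemmas pattern_simps = length_Suc_conv numeral_eq_Suc All_less_Suc2

text \<open>Each of the two edges has an end in the clique, and these ends would be
  adjacent.\<close>

lemma split_no_2P2:
  assumes "inj_on dec {..<n}"
  shows "\<not> has_induced (graph_on n (\<lambda>u v. adj False x y (dec u) (dec v)))
    (pattern 4 {(0, 1), (2, 3)})"
proof
  assume "has_induced (graph_on n (\<lambda>u v. adj False x y (dec u) (dec v)))
    (pattern 4 {(0, 1), (2, 3)})"
  then obtain a b c d where "distinct [a, b, c, d]"
    and "adj False x y a b" "adj False x y c d"
      "\<not> adj False x y a c" "\<not> adj False x y a d" "\<not> adj False x y b c" "\<not> adj False x y b d"
    by (rule has_induced_pullbackE[OF _ assms]) (auto simp: pattern_simps)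
  then show False
    using split_adj(2)[where x = x and y = y, of a c] split_adj(2)[where x = x and y = y, of a d]
      split_adj(2)[where x = x and y = y, of b c] split_adj(2)[where x = x and y = y, of b d]
    by (auto dest!: split_adj(1))
qed

text \<open>The hubs meet every edge of the cycle, hence include two opposite vertices, which would
  be adjacent.\<close>

lemma split_no_C4:
  assumes "inj_on dec {..<n}"
  shows "\<not> has_induced (graph_on n (\<lambda>u v. adj False x y (dec u) (dec v)))
    (pattern 4 {(0, 1), (1, 2), (2, 3), (3, 0)})"
proof
  assume "has_induced (graph_on n (\<lambda>u v. adj False x y (dec u) (dec v)))
    (pattern 4 {(0, 1), (1, 2), (2, 3), (3, 0)})"
  then obtain a b c d where "distinct [a, b, c, d]"
    and "adj False x y a b" "adj False x y b c" "adj False x y c d" "adj False x y d a"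
      "\<not> adj False x y a c" "\<not> adj False x y b d"
    by (rule has_induced_pullbackE[OF _ assms]) (auto simp: pattern_simps)
  then show False
    using split_adj(2)[where x = x and y = y, of a c] split_adj(2)[where x = x and y = y, of b d]
    by (auto dest!: split_adj(1))
qed

text \<open>Meeting all edges of a 5-cycle takes three vertices, two of which are non-adjacent on
  the cycle, whereas hubs are adjacent.\<close>

lemma split_no_C5:
  assumes "inj_on dec {..<n}"
  shows "\<not> has_induced (graph_on n (\<lambda>u v. adj False x y (dec u) (dec v)))
    (pattern 5 {(0, 1), (1, 2), (2, 3), (3, 4), (4, 0)})"
proof
  assume "has_induced (graph_on n (\<lambda>u v. adj False x y (dec u) (dec v)))
    (pattern 5 {(0, 1), (1, 2), (2, 3), (3, 4), (4, 0)})"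
  then obtain a b c d e where "distinct [a, b, c, d, e]"
    and "adj False x y a b" "adj False x y b c" "adj False x y c d" "adj False x y d e" "adj False x y e a"
      "\<not> adj False x y a c" "\<not> adj False x y a d" "\<not> adj False x y b d"
      "\<not> adj False x y b e" "\<not> adj False x y c e"
    by (rule has_induced_pullbackE[OF _ assms]) (auto simp: pattern_simps)
  then show False
    using split_adj(2)[where x = x and y = y, of a c] split_adj(2)[where x = x and y = y, of a d]
      split_adj(2)[where x = x and y = y, of b d] split_adj(2)[where x = x and y = y, of b e]
      split_adj(2)[where x = x and y = y, of c e]
    by (auto dest!: split_adj(1))
qed

section \<open>Induced subgraphs excluded from the three cliques\<close>

definition part :: "vertex \<Rightarrow> nat" where
  "part u = (case u of AV _ \<Rightarrow> 0 | BV _ \<Rightarrow> 1 | _ \<Rightarrow> 2)"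

lemma part_adj: "part u = part v \<Longrightarrow> u \<noteq> v \<Longrightarrow> adj True x y u v"
  by (cases u; cases v) (auto simp: adj_def part_def)

lemma part_less: "part u < 3"
  by (cases u) (auto simp: part_def)

text \<open>Pigeonhole: two of four vertices share one of the three cliques.\<close>

lemma cliques_no_4P1:
  assumes "inj_on dec {..<n}"
  shows "\<not> has_induced (graph_on n (\<lambda>u v. adj True x y (dec u) (dec v))) (pattern 4 {})"
proof
  assume "has_induced (graph_on n (\<lambda>u v. adj True x y (dec u) (dec v))) (pattern 4 {})"
  then obtain vs where vs: "length vs = 4" "distinct vs"
      "\<forall>i<4. \<forall>j<4. \<not> adj True x y (vs ! i) (vs ! j)"
    by (rule has_induced_pullbackE[OF _ assms]) auto
  have "inj_on (\<lambda>i. part (vs ! i)) {..<4}"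
    unfolding inj_on_def using vs part_adj by (metis lessThan_iff nth_eq_iff_index_eq)
  then have "card {..<4::nat} \<le> card {..<3::nat}"
    by (rule card_inj_on_le) (auto simp: part_less)
  then show False by simp
qed

text \<open>The path lies among the non-neighbours of the isolated vertex \<open>e\<close>. An
  induced path on four vertices has no vertex adjacent to all its others, and two cliques cover it
  only by its two end edges.\<close>

lemma cliques_no_P4_P1:
  assumes "inj_on dec {..<n}"
  shows "\<not> has_induced (graph_on n (\<lambda>u v. adj True x y (dec u) (dec v)))
    (pattern 5 {(0, 1), (1, 2), (2, 3)})"
proof
  assume "has_induced (graph_on n (\<lambda>u v. adj True x y (dec u) (dec v)))
    (pattern 5 {(0, 1), (1, 2), (2, 3)})"
  then obtain vs where vs: "length vs = 5" "distinct vs"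
      "\<forall>i<5. \<forall>j<5. adj True x y (vs ! i) (vs ! j) \<longleftrightarrow>
        (i, j) \<in> {(0, 1), (1, 2), (2, 3)} \<or> (j, i) \<in> {(0, 1), (1, 2), (2, 3 :: nat)}"
    by (rule has_induced_pullbackE[OF _ assms])
  then obtain a b c d e where "vs = [a, b, c, d, e]"
    by (auto simp: length_Suc_conv numeral_eq_Suc)
  with vs have dist: "distinct [a, b, c, d, e]"
    and adj: "adj True x y a b" "adj True x y b c" "adj True x y c d"
      "\<not> adj True x y a c" "\<not> adj True x y a d" "\<not> adj True x y b d"
      "\<not> adj True x y a e" "\<not> adj True x y b e" "\<not> adj True x y c e" "\<not> adj True x y d e"
    by (auto simp: numeral_eq_Suc All_less_Suc2)
  show False
  proof (cases e)
    case (AV i)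
    \<comment> \<open>\<open>CV\<close> is adjacent to all others listed, so the path would have two
      vertices \<open>BV\<close> and two \<open>WV\<close>. Its ends miss both vertices of the other
      kind, but a vertex of one kind misses only one of the other.\<close>
    have "(\<exists>j. u = BV j) \<or> (\<exists>j. u = WV j \<and> j \<noteq> i) \<or> u = CV"
      if "\<not> adj True x y u e" "u \<noteq> e" for u
      using that AV by (cases u) (auto simp: adj_def)
    then show False using adj dist
      by (smt (verit) adj_def distinct_length_2_or_more half_adj.simps)
  next
    case (BV i)
    \<comment> \<open>\<open>DV\<close> is adjacent to all others listed, and these are a clique and
      one more vertex.\<close>
    have "(\<exists>j. u = AV j) \<or> u = WV i \<or> u = DV" if "\<not> adj True x y u e" "u \<noteq> e" for u
      using that BV by (cases u) (auto simp: adj_def)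
    then show False using adj dist
      by (smt (verit) adj_def distinct_length_2_or_more half_adj.simps)
  next
    case (WV i)
    have "(\<exists>j. u = AV j) \<or> u = BV i" if "\<not> adj True x y u e" "u \<noteq> e" for u
      using that WV by (cases u) (auto simp: adj_def)
    then show False using adj dist
      by (smt (verit) adj_def distinct_length_2_or_more half_adj.simps)
  next
    case CV
    have "(\<exists>j. u = AV j)" if "\<not> adj True x y u e" "u \<noteq> e" for u
      using that CV by (cases u) (auto simp: adj_def)
    then show False using adj dist
      by (smt (verit) adj_def distinct_length_2_or_more half_adj.simps)
  next
    case DV
    have "(\<exists>j. u = BV j)" if "\<not> adj True x y u e" "u \<noteq> e" for u
      using that DV by (cases u) (auto simp: adj_def)
    then show False using adj dist
      by (smt (verit) adj_def distinct_length_2_or_more half_adj.simps)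
  qed
qed

section \<open>Unions of two matchings\<close>

text \<open>
  For \<open>x = y = {}\<close> the matchings \<open>{u, partner u}\<close> and \<open>{u, mate u}\<close> form the path \<open>0, 1, 2, \<dots>\<close>. Within
  the block of the eight vertices \<open>8 i + r\<close>, the element \<open>i \<in> y\<close> replaces the edges \<open>12\<close>, \<open>56\<close> of \<open>mate\<close> by
  \<open>15\<close>, \<open>26\<close>, and \<open>i \<in> x\<close> replaces \<open>34\<close>, \<open>78\<close> by \<open>37\<close>, \<open>48\<close>. One of the two changes alone reorders the path,
  but both together cut off the cycle \<open>2, 3, 7, 6\<close>. Vertex 0 has no mate, encoded by \<open>mate x y 0 = 0\<close>.
\<close>

definition partner :: "nat \<Rightarrow> nat" where
  "partner u = (if even u then u + 1 else u - 1)"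

definition mate :: "nat set \<Rightarrow> nat set \<Rightarrow> nat \<Rightarrow> nat" where
  "mate x y u = (let i = u div 8; r = u mod 8 in
     if r = 0 then (if u = 0 then 0 else if i - 1 \<in> x then u - 4 else u - 1)
     else if r = 1 then (if i \<in> y then u + 4 else u + 1)
     else if r = 2 then (if i \<in> y then u + 4 else u - 1)
     else if r = 3 then (if i \<in> x then u + 4 else u + 1)
     else if r = 4 then (if i \<in> x then u + 4 else u - 1)
     else if r = 5 then (if i \<in> y then u - 4 else u + 1)
     else if r = 6 then (if i \<in> y then u - 4 else u - 1)
     else (if i \<in> x then u - 4 else u + 1))"

text \<open>Offsets run from 1 to 8: a positive multiple of 8 closes the preceding block, so that
  its edge is governed by the same \<open>i\<close> as the other edges of that block.\<close>

lemma mate_eqs: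
  "mate x y 0 = 0"
  "mate x y (8 * i + 1) = (if i \<in> y then 8 * i + 5 else 8 * i + 2)"
  "mate x y (8 * i + 2) = (if i \<in> y then 8 * i + 6 else 8 * i + 1)"
  "mate x y (8 * i + 3) = (if i \<in> x then 8 * i + 7 else 8 * i + 4)"
  "mate x y (8 * i + 4) = (if i \<in> x then 8 * i + 8 else 8 * i + 3)"
  "mate x y (8 * i + 5) = (if i \<in> y then 8 * i + 1 else 8 * i + 6)"
  "mate x y (8 * i + 6) = (if i \<in> y then 8 * i + 2 else 8 * i + 5)"
  "mate x y (8 * i + 7) = (if i \<in> x then 8 * i + 3 else 8 * i + 8)"
  "mate x y (8 * i + 8) = (if i \<in> x then 8 * i + 4 else 8 * i + 7)"
proof -
  have "Suc (8 * i) div 8 = i" "Suc (8 * i) mod 8 = 1"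
    "Suc (Suc (8 * i)) div 8 = i" "Suc (Suc (8 * i)) mod 8 = 2" by presburger+
  then show "mate x y (8 * i + 1) = (if i \<in> y then 8 * i + 5 else 8 * i + 2)"
    "mate x y (8 * i + 2) = (if i \<in> y then 8 * i + 6 else 8 * i + 1)"
    by (simp_all add: mate_def)
qed (simp_all add: mate_def Let_def mod_simps)

lemmas mate_simps = mate_eqs[simplified]

lemma mod_8_cases:
  fixes u :: nat
  obtains "u = 0" | i where "u = 8 * i + 1" | i where "u = 8 * i + 2" | i where "u = 8 * i + 3"
    | i where "u = 8 * i + 4" | i where "u = 8 * i + 5" | i where "u = 8 * i + 6"
    | i where "u = 8 * i + 7" | i where "u = 8 * i + 8"
proof -
  have "\<exists>i. u = 0 \<or> u = 8 * i + 1 \<or> u = 8 * i + 2 \<or> u = 8 * i + 3 \<or> u = 8 * i + 4 \<or>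
    u = 8 * i + 5 \<or> u = 8 * i + 6 \<or> u = 8 * i + 7 \<or> u = 8 * i + 8" by presburger
  then show thesis using that by blast
qed

text \<open>Each rewiring exchanges two edges for two others on the same four vertices, so
  \<open>mate\<close> stays an involution.\<close>

lemma mate_mate: "mate x y (mate x y u) = u"
  by (cases u rule: mod_8_cases) (simp_all add: mate_simps)

lemma partner_partner: "partner (partner u) = u"
  by (auto simp: partner_def)

text \<open>The condition \<open>u \<noteq> v\<close> discards the loop at 0.\<close>

definition route :: "nat set \<Rightarrow> nat set \<Rightarrow> nat \<Rightarrow> nat \<Rightarrow> bool" where
  "route x y u v \<longleftrightarrow> u \<noteq> v \<and> (v = partner u \<or> v = mate x y u)"

lemma route_sym: "route x y u v \<Longrightarrow> route x y v u"
  unfolding route_def using mate_mate partner_partner by metis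

text \<open>Two neighbours of \<open>a\<close> come from different matchings; an edge joining them
  would lie in one of these, where one of its ends is already matched to \<open>a\<close>.\<close>

lemma route_no_triangle:
  assumes "route x y a b" "route x y b c" "route x y a c"
  shows False
proof -
  have "b = partner a \<and> c = mate x y a \<or> b = mate x y a \<and> c = partner a"
    using assms by (auto simp: route_def)
  moreover have "c = partner b \<or> c = mate x y b" "a \<noteq> b" "a \<noteq> c"
    using assms by (auto simp: route_def)
  ultimately show False
    using partner_partner[of a] partner_partner[of b] mate_mate[of x y a] mate_mate[of x y b] by auto
qed

lemma route_no_claw:
  assumes "route x y a b" "route x y a c" "route x y a d" "b \<noteq> c" "b \<noteq> d" "c \<noteq> d"
  shows False
  using assms unfolding route_def by auto

lemma route_avoids:
  "\<not> has_induced (graph_on n (route x y)) (pattern 3 {(0, 1), (1, 2), (0, 2)})"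
  "\<not> has_induced (graph_on n (route x y)) (pattern 4 {(0, 1), (0, 2), (0, 3)})"
proof -
  note simps = has_induced_graph_on_iff[OF pair_wf_digraph_graph_on] pattern_simps
  show "\<not> has_induced (graph_on n (route x y)) (pattern 3 {(0, 1), (1, 2), (0, 2)})"
    by (auto simp: simps dest: route_no_triangle)
  show "\<not> has_induced (graph_on n (route x y)) (pattern 4 {(0, 1), (0, 2), (0, 3)})"
    by (auto simp: simps dest: route_no_claw)
qed

section \<open>Connectivity and diameter of the unions of matchings\<close>

text \<open>Each block is traversed from \<open>8 * i\<close> to \<open>8 * i + 8\<close>, visiting
  the offsets in the order 1 2 3 7 6 5 4 8 for \<open>i \<in> x\<close>, 1 5 4 3 2 6 7 8 for
  \<open>i \<in> y\<close>, and 1 to 8 otherwise.\<close>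

lemma connected_route:
  assumes disj: "x \<inter> y = {}" and xy: "x \<subseteq> {..<k}" "y \<subseteq> {..<k}" and k: "8 * k \<le> n" and u: "u < n"
  shows "(0, u) \<in> (parcs (graph_on n (route x y)))\<^sup>*"
proof -
  let ?R = "parcs (graph_on n (route x y))"
  have partner: "partner (8 * i) = 8 * i + 1" "partner (8 * i + 2) = 8 * i + 3" "partner (8 * i + 3) = 8 * i + 2"
    "partner (8 * i + 4) = 8 * i + 5" "partner (8 * i + 5) = 8 * i + 4"
    "partner (8 * i + 6) = 8 * i + 7" "partner (8 * i + 7) = 8 * i + 6" for i
    by (simp_all add: partner_def)
  note partner = this[simplified]
  \<comment> \<open>The guard \<open>8 * i + r < n\<close> accounts for a block cut off by
    \<open>n\<close>.\<close>
  define c where "c i r \<longleftrightarrow> (8 * i + r < n \<longrightarrow> (0, 8 * i + r) \<in> ?R\<^sup>*)" for i r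
  have gadget: "c i 0 \<and> c i 1 \<and> c i 2 \<and> c i 3 \<and> c i 4 \<and> c i 5 \<and> c i 6 \<and> c i 7 \<and> c i 8"
    if "c i 0" for i
  proof -
    have step: "c i s" if "c i r" "8 * i + s < n \<Longrightarrow> 8 * i + r < n" "r \<noteq> s"
        "8 * i + s = partner (8 * i + r) \<or> 8 * i + s = mate x y (8 * i + r)" for r s
      using that unfolding c_def by (auto simp: route_def intro: rtrancl_into_rtrancl)
    have 1: "c i 1" by (rule step[OF \<open>c i 0\<close>]) (auto simp: partner)
    \<comment> \<open>A rewired block has \<open>i < k\<close>, so its offsets up to 7 lie below
      \<open>n\<close> and may be visited out of order. In a block cut off by \<open>n\<close> the
      offsets increase, so earlier vertices are present.\<close>
    consider "i \<in> x" "i \<notin> y" "8 * i + 7 < n" | "i \<notin> x" "i \<in> y" "8 * i + 7 < n" | "i \<notin> x" "i \<notin> y"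
      using disj xy k by fastforce
    then show ?thesis
    proof cases
      case i: 1
      have 2: "c i 2" by (rule step[OF 1]) (use i in \<open>auto simp: mate_simps\<close>)
      have 3: "c i 3" by (rule step[OF 2]) (use i in \<open>auto simp: partner\<close>)
      have 7: "c i 7" by (rule step[OF 3]) (use i in \<open>auto simp: mate_simps\<close>)
      have 6: "c i 6" by (rule step[OF 7]) (use i in \<open>auto simp: partner\<close>)
      have 5: "c i 5" by (rule step[OF 6]) (use i in \<open>auto simp: mate_simps\<close>)
      have 4: "c i 4" by (rule step[OF 5]) (use i in \<open>auto simp: partner\<close>)
      have 8: "c i 8" by (rule step[OF 4]) (use i in \<open>auto simp: mate_simps\<close>)
      show ?thesis using that 1 2 3 4 5 6 7 8 by blast
    next
      case i: 2
      have 5: "c i 5" by (rule step[OF 1]) (use i in \<open>auto simp: mate_simps\<close>)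
      have 4: "c i 4" by (rule step[OF 5]) (use i in \<open>auto simp: partner\<close>)
      have 3: "c i 3" by (rule step[OF 4]) (use i in \<open>auto simp: mate_simps\<close>)
      have 2: "c i 2" by (rule step[OF 3]) (use i in \<open>auto simp: partner\<close>)
      have 6: "c i 6" by (rule step[OF 2]) (use i in \<open>auto simp: mate_simps\<close>)
      have 7: "c i 7" by (rule step[OF 6]) (use i in \<open>auto simp: partner\<close>)
      have 8: "c i 8" by (rule step[OF 7]) (use i in \<open>auto simp: mate_simps\<close>)
      show ?thesis using that 1 2 3 4 5 6 7 8 by blast
    next
      case i: 3
      have 2: "c i 2" by (rule step[OF 1]) (use i in \<open>auto simp: mate_simps\<close>)
      have 3: "c i 3" by (rule step[OF 2]) (use i in \<open>auto simp: partner\<close>)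
      have 4: "c i 4" by (rule step[OF 3]) (use i in \<open>auto simp: mate_simps\<close>)
      have 5: "c i 5" by (rule step[OF 4]) (use i in \<open>auto simp: partner\<close>)
      have 6: "c i 6" by (rule step[OF 5]) (use i in \<open>auto simp: mate_simps\<close>)
      have 7: "c i 7" by (rule step[OF 6]) (use i in \<open>auto simp: partner\<close>)
      have 8: "c i 8" by (rule step[OF 7]) (use i in \<open>auto simp: mate_simps\<close>)
      show ?thesis using that 1 2 3 4 5 6 7 8 by blast
    qed
  qed
  have "c i 0" for i
  proof (induction i)
    case 0
    show ?case by (simp add: c_def)
  next
    case (Suc i)
    then have "c i 8" using gadget by blast
    then show ?case by (simp add: c_def add.commute)
  qed
  moreover have "u mod 8 \<in> {0, 1, 2, 3, 4, 5, 6, 7}" by auto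
  ultimately have "c (u div 8) (u mod 8)" using gadget[of "u div 8"] by auto
  then show ?thesis using u by (simp add: c_def)
qed

text \<open>The threshold only tests connectivity: reachable vertices are joined by a walk no longer
  than the number of arcs, which is at most \<open>n * n\<close>.\<close>

lemma diameter_route_le_iff:
  assumes xy: "x \<subseteq> {..<k}" "y \<subseteq> {..<k}" and k: "8 * k \<le> n"
  shows "diameter (graph_on n (route x y)) \<le> ereal (real (n * n)) \<longleftrightarrow> x \<inter> y = {}"
proof -
  let ?R = "parcs (graph_on n (route x y))"
  have "(\<exists>j\<le>n * n. (u, v) \<in> ?R ^^ j) \<longleftrightarrow> (u, v) \<in> ?R\<^sup>*" for u v
  proof
    assume "(u, v) \<in> ?R\<^sup>*"
    then obtain j where "j \<le> card ?R" "(u, v) \<in> ?R ^^ j"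
      unfolding rtrancl_finite_eq_relpow[OF finite_parcs_graph_on] by blast
    then show "\<exists>j\<le>n * n. (u, v) \<in> ?R ^^ j"
      using card_parcs_graph_on order_trans by blast
  qed (auto intro: relpow_imp_rtrancl)
  then have le_iff: "diameter (graph_on n (route x y)) \<le> ereal (real (n * n)) \<longleftrightarrow>
      (\<forall>u<n. \<forall>v<n. (u, v) \<in> ?R\<^sup>*)"
    unfolding diameter_le_iff[OF pair_wf_digraph_graph_on] by auto
  show ?thesis
  proof
    assume "x \<inter> y = {}"
    moreover have "sym (?R\<^sup>*)"
      by (intro sym_rtrancl symI) (auto intro: route_sym)
    ultimately show "diameter (graph_on n (route x y)) \<le> ereal (real (n * n))"
      unfolding le_iff using connected_route[OF _ xy k] by (meson rtrancl_trans symD)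
  next
    assume "diameter (graph_on n (route x y)) \<le> ereal (real (n * n))"
    then have conn: "(u, v) \<in> ?R\<^sup>*" if "u < n" "v < n" for u v
      using that unfolding le_iff by blast
    show "x \<inter> y = {}"
    proof (rule equals0I)
      fix i assume i: "i \<in> x \<inter> y"
      then have "i < k" using xy by auto
      \<comment> \<open>The cycle cut off by the two rewirings: closed under adjacency and without
        the vertex 0.\<close>
      let ?T = "{8 * i + 2, 8 * i + 3, 8 * i + 6, 8 * i + 7}"
      have "v \<in> ?T" if "(8 * i + 2, v) \<in> ?R\<^sup>*" for v
        using that
      proof (induction rule: rtrancl_induct)
        case (step a b)
        then show ?case using i
          by (auto simp: route_def mate_simps partner_def)
      qed simp
      moreover have "(8 * i + 2, 0) \<in> ?R\<^sup>*" using \<open>i < k\<close> k by (intro conn) auto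
      ultimately show False by fastforce
    qed
  qed
qed

text \<open>At these residues \<open>mate\<close> consults \<open>x\<close> only; residue 0 does so
  through the preceding block.\<close>

lemma route_left:
  assumes "u mod 8 \<in> {0, 3, 4, 7}" "route x y u v"
  shows "route x y' u v"
proof -
  have "mate x y' u = mate x y u"
    using assms(1) by (elim insertE emptyE) (simp_all add: mate_def)
  with assms(2) show ?thesis by (simp add: route_def)
qed

lemma route_right:
  assumes "u mod 8 \<notin> {0, 3, 4, 7}" "route x y u v"
  shows "route x' y u v"
proof -
  have "u mod 8 \<in> {1, 2, 5, 6}" using assms(1) by simp presburger
  then have "mate x' y u = mate x y u"
    by (elim insertE emptyE) (simp_all add: mate_def)
  with assms(2) show ?thesis by (simp add: route_def)
qed

section \<open>The lower bound\<close>

lemma streaming_lower_bound: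
  fixes F :: "nat set \<Rightarrow> nat set \<Rightarrow> nat \<Rightarrow> nat \<Rightarrow> bool" and S :: "nat set"
  assumes sym: "\<And>x y u v. F x y u v \<Longrightarrow> F x y v u" and irrefl: "\<And>x y u. \<not> F x y u u"
    and S: "\<And>x y y' u v. u \<in> S \<Longrightarrow> F x y u v \<Longrightarrow> F x y' u v"
    and not_S: "\<And>x x' y u v. u \<notin> S \<Longrightarrow> F x y u v \<Longrightarrow> F x' y u v"
    and diameter: "\<And>x y. x \<subseteq> {..<n div 8} \<Longrightarrow> y \<subseteq> {..<n div 8} \<Longrightarrow>
      diameter (graph_on n (F x y)) \<le> d \<longleftrightarrow> x \<inter> y = {}"
    and free: "\<And>x y. \<not> has_induced (graph_on n (F x y)) H"
    and A: "solves_diameter A p (\<Union>m. free_graphs H m)"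
    and "n \<ge> 8" "p \<ge> 1"
  shows "\<exists>G\<in>free_graphs H n. \<exists>xs. al_stream G xs \<and>
    1 / 64 * (real n / real p) \<le> real (bits_used A p xs)"
proof -
  have G: "graph_on n (F x y) \<in> free_graphs H n" for x y
    unfolding free_graphs_def using free sym irrefl by (simp add: pair_graph_graph_on)
  have "\<exists>x y xs. al_stream (graph_on n (F x y)) xs \<and> n div 8 \<le> 4 * p * bits_used A p xs"
    by (rule disjointness_bits_used[where F = F and S = S and d = d and \<G> = "\<Union>m. free_graphs H m"])
      (fact sym irrefl S not_S diameter A | use G in blast)+
  then obtain x y xs where xs: "al_stream (graph_on n (F x y)) xs" "n div 8 \<le> 4 * p * bits_used A p xs"
    by blast
  \<comment> \<open>For \<open>n \<ge> 8\<close> rounding costs less than a factor 2; with the 8 and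
    the 4 of the protocol bound this makes 64.\<close>
  have "n \<le> 16 * (n div 8)" using \<open>n \<ge> 8\<close> by presburger
  also have "\<dots> \<le> 16 * (4 * p * bits_used A p xs)" using xs(2) by simp
  finally have "real n \<le> real (64 * p * bits_used A p xs)"
    by (simp only: of_nat_le_iff)
  then have "1 / 64 * (real n / real p) \<le> real (bits_used A p xs)"
    using \<open>p \<ge> 1\<close> by (simp add: field_simps)
  then show ?thesis using G xs(1) by blast
qed

theorem theorem2:
  fixes H :: "'a pair_pre_digraph"
  assumes "pair_graph H"
    and "\<not> has_induced (path_graph 4) H"
    and "\<not> isomorphic H (copies 3 (path_graph 1))"
    and "\<not> isomorphic H (disjoint_union (path_graph 3) (path_graph 1))"
    and "\<not> isomorphic H (disjoint_union (path_graph 2) (copies 2 (path_graph 1)))"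
  shows "\<exists>c::real. c > 0 \<and> (\<exists>N::nat. \<forall>n\<ge>N. \<forall>p\<ge>1. \<forall>A.
           solves_diameter A p (\<Union>m. free_graphs H m) \<longrightarrow>
           (\<exists>G\<in>free_graphs H n. \<exists>xs. al_stream G xs \<and>
              c * (real n / real p) \<le> real (bits_used A p xs)))"
proof (intro exI[of _ "1 / 64 :: real"] conjI exI[of _ 8] allI impI)
  fix n p :: nat and A
  assume n: "n \<ge> 8" and p: "p \<ge> 1" and A: "solves_diameter A p (\<Union>m. free_graphs H m)"
  \<comment> \<open>The matchings need eight vertices per element; the other two families use the
    same \<open>k\<close> and absorb the surplus vertices in \<open>m\<close>.\<close>
  define k where "k = n div 8"
  define m where "m = n - 2 * k - 2"
  have "8 * k \<le> n" "k \<ge> 1" using n by (auto simp: k_def)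
  then have m: "k \<le> m" "m + 2 * k + 2 = n" by (auto simp: m_def)
  obtain dec where dec: "bij_betw dec {..<n} (vertices m k)"
    using ex_bij_betw_nat_finite[OF finite_vertices, of m k] m by (auto simp: card_vertices atLeast0LessThan)
  then have inj: "inj_on dec {..<n}" by (simp add: bij_betw_def)
  let ?bound = "\<exists>G\<in>free_graphs H n. \<exists>xs. al_stream G xs \<and>
      1 / 64 * (real n / real p) \<le> real (bits_used A p xs)"
  let ?clique = "\<lambda>t x y u v. adj t x y (dec u) (dec v)"
  have free: "\<not> has_induced (graph_on n F) H"
    if "has_induced H (pattern l es)" "\<not> has_induced (graph_on n F) (pattern l es)" for l es F
    using that has_induced_trans pair_wf_digraph_graph_on by blast
  \<comment> \<open>The kinds in the first half include \<open>AV\<close> and \<open>CV\<close>,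
    whose adjacency encodes \<open>x\<close>; \<open>BV\<close> and \<open>DV\<close>, which encode
    \<open>y\<close>, are in the second half.\<close>
  let ?S = "{u. case dec u of BV _ \<Rightarrow> False | DV \<Rightarrow> False | _ \<Rightarrow> True}"
  have clique: ?bound if "\<And>x y. \<not> has_induced (graph_on n (?clique t x y)) H" for t
  proof (rule streaming_lower_bound[where F = "?clique t" and S = ?S and d = 2, OF _ _ _ _ _ that A n p])
    show "\<not> ?clique t x y u u" for x y u by (cases "dec u") (auto simp: adj_def)
    show "?clique t x y' u v" if "u \<in> ?S" "?clique t x y u v" for x y y' u v
      using that by (cases "dec u"; cases "dec v") (auto simp: adj_def)
    show "?clique t x' y u v" if "u \<notin> ?S" "?clique t x y u v" for x x' y u v
      using that by (cases "dec u"; cases "dec v") (auto simp: adj_def)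
  qed (use diameter_adj_le_two_iff[OF dec _ _ m(1)] in \<open>auto simp: adj_def k_def\<close>)
  have route: ?bound if "\<And>x y. \<not> has_induced (graph_on n (route x y)) H"
  proof (rule streaming_lower_bound[where F = route and S = "{u. u mod 8 \<in> {0, 3, 4, 7}}"
        and d = "ereal (real (n * n))", OF route_sym _ _ _ _ that A n p])
    show "\<not> route x y u u" for x y u by (simp add: route_def)
    show "route x y' u v" if "u \<in> {u. u mod 8 \<in> {0, 3, 4, 7}}" "route x y u v" for x y y' u v
      using that unfolding mem_Collect_eq by (rule route_left)
    show "route x' y u v" if "u \<notin> {u. u mod 8 \<in> {0, 3, 4, 7}}" "route x y u v" for x x' y u v
      using that unfolding mem_Collect_eq by (rule route_right)
    show "diameter (graph_on n (route x y)) \<le> ereal (real (n * n)) \<longleftrightarrow> x \<inter> y = {}"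
      if "x \<subseteq> {..<n div 8}" "y \<subseteq> {..<n div 8}" for x y
      using that by (intro diameter_route_le_iff) auto
  qed
  show ?bound
  proof (rule ccontr)
    \<comment> \<open>If the bound fails, no family is entirely \<open>H\<close>-free, so by
      transitivity \<open>H\<close> contains none of the seven patterns that the families
      avoid.\<close>
    assume not_bound: "\<not> ?bound"
    have no_clique: "\<not> has_induced H (pattern l es)"
      if "\<And>x y. \<not> has_induced (graph_on n (?clique t x y)) (pattern l es)" for l es t
      using not_bound clique[of t] free that by blast
    have no_route: "\<not> has_induced H (pattern l es)"
      if "\<And>x y. \<not> has_induced (graph_on n (route x y)) (pattern l es)" for l es
      using not_bound route free that by blast
    show False
      by (rule exceptional_if_no_pattern[OF assms no_route[OF route_avoids(1)] no_route[OF route_avoids(2)]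
            no_clique[OF split_no_2P2[OF inj]] no_clique[OF split_no_C4[OF inj]]
            no_clique[OF split_no_C5[OF inj]] no_clique[OF cliques_no_4P1[OF inj]]
            no_clique[OF cliques_no_P4_P1[OF inj]]])
  qed
qed simp

end
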